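(* For $n\ge 3$, every $\operatorname{IA}$ automorphism of $T_n$ is inner.
   Context: For an integer $n\ge 2$, the twin group $T_n$ is the group generated by $s_1,\dots,s_{n-1}$ with defining relations $s_i^2=1$ for all $i$, and $s_is_j=s_js_i$ whenever $|i-j|\ge 2$. An $\operatorname{IA}$ automorphism of a group is an automorphism that acts as the identity on the abelianization of the group. *)

theory Defs
  imports "HOL-Algebra.Bij" "HOL-Algebra.Generated_Groups"
begin

section \<open>Groups given by generators and relations\<close>

text \<open>
  A word over \<open>S\<close> is a list of signed letters: \<open>(a, True)\<close> stands for the generator \<open>a\<close> and
  \<open>(a, False)\<close> for its formal inverse. A defining relation \<open>l = r\<close> is a pair \<open>(l, r)\<close> of words.
\<close>

type_synonym 'a word = "('a \<times> bool) list"

definition words :: "'a set \<Rightarrow> 'a word set" where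
  "words S = lists (S \<times> UNIV)"

inductive_set word_rel :: "'a set \<Rightarrow> ('a word \<times> 'a word) set \<Rightarrow> ('a word \<times> 'a word) set"
  for S R where
  refl: "w \<in> words S \<Longrightarrow> (w, w) \<in> word_rel S R"
| sym: "(v, w) \<in> word_rel S R \<Longrightarrow> (w, v) \<in> word_rel S R"
| trans: "(u, v) \<in> word_rel S R \<Longrightarrow> (v, w) \<in> word_rel S R \<Longrightarrow> (u, w) \<in> word_rel S R"
| cancel: "u \<in> words S \<Longrightarrow> v \<in> words S \<Longrightarrow> a \<in> S \<Longrightarrow>
    (u @ [(a, b), (a, \<not> b)] @ v, u @ v) \<in> word_rel S R"
| relation: "u \<in> words S \<Longrightarrow> v \<in> words S \<Longrightarrow> (l, r) \<in> R \<Longrightarrow> l \<in> words S \<Longrightarrow> r \<in> words S \<Longrightarrow>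
    (u @ l @ v, u @ r @ v) \<in> word_rel S R"

definition presented_group :: "'a set \<Rightarrow> ('a word \<times> 'a word) set \<Rightarrow> 'a word set monoid" where
  "presented_group S R =
    \<lparr>carrier = words S // word_rel S R,
     mult = (\<lambda>A B. \<Union>v\<in>A. \<Union>w\<in>B. word_rel S R `` {v @ w}),
     one = word_rel S R `` {[]}\<rparr>"

lemma words_Nil [simp]: "[] \<in> words S"
  and words_append [simp]: "v @ w \<in> words S \<longleftrightarrow> v \<in> words S \<and> w \<in> words S"
  and words_Cons [simp]: "x # w \<in> words S \<longleftrightarrow> fst x \<in> S \<and> w \<in> words S"
  by (auto simp: words_def mem_Times_iff)

lemma word_rel_words: "(v, w) \<in> word_rel S R \<Longrightarrow> v \<in> words S \<and> w \<in> words S"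
  by (induction rule: word_rel.induct) auto

lemma equiv_word_rel: "equiv (words S) (word_rel S R)"
proof (rule equivI)
  show "word_rel S R \<subseteq> words S \<times> words S" using word_rel_words by fast
  show "refl_on (words S) (word_rel S R)"
    by (auto intro: refl_onI word_rel.refl dest: word_rel_words)
  show "Relation.sym (word_rel S R)" by (rule symI) (rule word_rel.sym)
  show "Relation.trans (word_rel S R)" by (rule transI) (rule word_rel.trans)
qed

lemma word_rel_context:
  assumes "(v, w) \<in> word_rel S R" "p \<in> words S" "q \<in> words S"
  shows "(p @ v @ q, p @ w @ q) \<in> word_rel S R"
  using assms
proof (induction rule: word_rel.induct)
  case (cancel u v a b)
  then show ?case using word_rel.cancel[of "p @ u" S "v @ q" a b R] by simp
next
  case (relation u v l r)
  then show ?case using word_rel.relation[of "p @ u" S "v @ q" l r R] by simp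
next
  case (refl w)
  then show ?case by (simp add: word_rel.refl)
next
  case (sym v w)
  then show ?case by (metis word_rel.sym)
next
  case (trans u v w)
  then show ?case by (metis word_rel.trans)
qed

lemma word_rel_append:
  assumes "(v, v') \<in> word_rel S R" "(w, w') \<in> word_rel S R"
  shows "(v @ w, v' @ w') \<in> word_rel S R"
proof -
  have "(v @ w, v' @ w) \<in> word_rel S R"
    using word_rel_context[OF assms(1), of "[]" w] word_rel_words[OF assms(2)] by simp
  moreover have "(v' @ w, v' @ w') \<in> word_rel S R"
    using word_rel_context[OF assms(2), of v' "[]"] word_rel_words[OF assms(1)] by simp
  ultimately show ?thesis by (rule word_rel.trans)
qed

lemma presented_group_mult:
  assumes "v \<in> words S" "w \<in> words S"
  shows "(word_rel S R `` {v}) \<otimes>\<^bsub>presented_group S R\<^esub> (word_rel S R `` {w})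
    = word_rel S R `` {v @ w}"
proof -
  let ?c = "\<lambda>u. word_rel S R `` {u}"
  have "(\<Union>v'\<in>?c v. \<Union>w'\<in>?c w. ?c (v' @ w')) = (\<Union>v'\<in>?c v. \<Union>w'\<in>?c w. ?c (v @ w))"
  proof (intro SUP_cong HOL.refl)
    fix v' w' assume "v' \<in> ?c v" "w' \<in> ?c w"
    then show "?c (v' @ w') = ?c (v @ w)"
      using equiv_class_eq[OF equiv_word_rel word_rel_append[of v v' S R w w']] by simp
  qed
  moreover have "v \<in> ?c v" "w \<in> ?c w"
    using assms by (simp_all add: word_rel.refl)
  then have "?c v \<noteq> {}" "?c w \<noteq> {}" by blast+
  ultimately show ?thesis
    by (simp add: presented_group_def)
qed

lemma word_rel_inverse:
  "w \<in> words S \<Longrightarrow> (rev (map (apsnd Not) w) @ w, []) \<in> word_rel S R"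
proof (induction w)
  case Nil
  then show ?case by (simp add: word_rel.refl)
next
  case (Cons x w)
  obtain a b where x: "x = (a, b)" by fastforce
  have mem: "rev (map (apsnd Not) w) \<in> words S"
    using Cons.prems by (auto simp: words_def in_lists_conv_set mem_Times_iff)
  have "(rev (map (apsnd Not) w) @ [(a, \<not> b), (a, \<not> \<not> b)] @ w,
      rev (map (apsnd Not) w) @ w) \<in> word_rel S R"
    using Cons.prems mem by (intro word_rel.cancel) (auto simp: x)
  moreover have "(rev (map (apsnd Not) w) @ w, []) \<in> word_rel S R"
    using Cons by simp
  ultimately have "(rev (map (apsnd Not) w) @ [(a, \<not> b), (a, \<not> \<not> b)] @ w, []) \<in> word_rel S R"
    by (rule word_rel.trans)
  then show ?case by (simp add: x)
qed

lemma group_presented_group: "group (presented_group S R)"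
proof (rule groupI)
  let ?G = "presented_group S R"
  have cls: "\<exists>w\<in>words S. x = word_rel S R `` {w}" if "x \<in> carrier ?G" for x
    using that by (auto simp: presented_group_def quotient_def)
  have mem: "word_rel S R `` {w} \<in> carrier ?G" if "w \<in> words S" for w
    using that by (auto simp: presented_group_def quotient_def)
  have one: "\<one>\<^bsub>?G\<^esub> = word_rel S R `` {[]}"
    by (simp add: presented_group_def)
  show "\<one>\<^bsub>?G\<^esub> \<in> carrier ?G" using mem by (simp add: one)
  fix x assume x: "x \<in> carrier ?G"
  then obtain v where v: "v \<in> words S" "x = word_rel S R `` {v}" using cls by blast
  show "\<one>\<^bsub>?G\<^esub> \<otimes>\<^bsub>?G\<^esub> x = x" using v by (simp add: one presented_group_mult)
  have "rev (map (apsnd Not) v) \<in> words S"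
    using v by (auto simp: words_def in_lists_conv_set mem_Times_iff)
  then show "\<exists>y\<in>carrier ?G. y \<otimes>\<^bsub>?G\<^esub> x = \<one>\<^bsub>?G\<^esub>"
    using v mem equiv_class_eq[OF equiv_word_rel word_rel_inverse]
    by (intro bexI[of _ "word_rel S R `` {rev (map (apsnd Not) v)}"])
      (simp_all add: one presented_group_mult)
  fix y assume "y \<in> carrier ?G"
  then obtain w where w: "w \<in> words S" "y = word_rel S R `` {w}" using cls by blast
  show "x \<otimes>\<^bsub>?G\<^esub> y \<in> carrier ?G" using v w mem by (simp add: presented_group_mult)
  fix z assume "z \<in> carrier ?G"
  then obtain u where "u \<in> words S" "z = word_rel S R `` {u}" using cls by blast
  then show "(x \<otimes>\<^bsub>?G\<^esub> y) \<otimes>\<^bsub>?G\<^esub> z = x \<otimes>\<^bsub>?G\<^esub> (y \<otimes>\<^bsub>?G\<^esub> z)"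
    using v w by (simp add: presented_group_mult)
qed

section \<open>Twin groups\<close>

definition twin_relations :: "nat \<Rightarrow> (nat word \<times> nat word) set" where
  "twin_relations n =
    {([(i, True), (i, True)], []) | i. i \<in> {1..n - 1}} \<union>
    {([(i, True), (j, True)], [(j, True), (i, True)]) | i j.
       i \<in> {1..n - 1} \<and> j \<in> {1..n - 1} \<and> \<bar>int i - int j\<bar> \<ge> 2}"

definition twin_group :: "nat \<Rightarrow> nat word set monoid" where
  "twin_group n = presented_group {1..n - 1} (twin_relations n)"

lemma group_twin_group: "group (twin_group n)"
  unfolding twin_group_def by (rule group_presented_group)

section \<open>IA and inner automorphisms\<close>

definition abelianization :: "('a, 'b) monoid_scheme \<Rightarrow> 'a set monoid" where
  "abelianization G = G Mod derived G (carrier G)"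

text \<open>
  The elements of the abelianization are the cosets of the commutator subgroup; the map induced
  by an automorphism \<open>\<phi>\<close> sends a coset \<open>C\<close> to its image \<open>\<phi> ` C\<close>.
\<close>

definition IA_automorphisms :: "('a, 'b) monoid_scheme \<Rightarrow> ('a \<Rightarrow> 'a) set" where
  "IA_automorphisms G = {\<phi> \<in> auto G. \<forall>C \<in> carrier (abelianization G). \<phi> ` C = C}"

text \<open>Elements of \<open>auto G\<close> are extensional, hence the restriction to the carrier.\<close>

definition inner_automorphisms :: "('a, 'b) monoid_scheme \<Rightarrow> ('a \<Rightarrow> 'a) set" where
  "inner_automorphisms G =
    {(\<lambda>x\<in>carrier G. g \<otimes>\<^bsub>G\<^esub> x \<otimes>\<^bsub>G\<^esub> inv\<^bsub>G\<^esub> g) | g. g \<in> carrier G}"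

end

theory Submission
  imports Defs
begin

text \<open>
  The group acts on integer labellings of \<open>{1..n - 1}\<close>: \<open>s i\<close> negates the label at \<open>i\<close> and adds
  twice the old label to the neighbours of \<open>i\<close> (Mozes' numbers game, dual to the Tits
  representation). Starting from the constant labelling 1, all labels stay odd, so their signs
  cut the group into half-spaces, one pair for each reflection. An IA automorphism sends \<open>s i\<close> to
  an involution with the same image in the abelianization, which is a conjugate of \<open>s i\<close>, i.e. a
  reflection. Reflections commute iff their walls cross. Since \<open>s (i - 1)\<close> and \<open>s (i + 1)\<close>
  commute, the walls of their images lie on the same side of the wall of \<open>\<phi> (s i)\<close>, so one can
  choose half-spaces bounded by the image walls such that non-crossing ones have disjoint
  complements. They have a common point \<open>x\<close> by a Helly argument, and by ping-pong and
  surjectivity it is the only one. Hence stepping from \<open>x\<close> to \<open>x s j\<close> crosses one of the image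
  walls, which forces \<open>\<phi> (s j) = x s j x\<inverse>\<close> for all \<open>j\<close>.
\<close>

section \<open>Right-angled Coxeter groups and the numbers game\<close>

text \<open>
  \<open>val x i\<close> is the label at \<open>i\<close> after \<open>x\<close> acts on the constant labelling 1, and \<open>par x i\<close> is the
  parity of the number of occurrences of \<open>s i\<close> in \<open>x\<close>. Both are parameters because their
  existence depends on how the group is constructed.
\<close>

locale right_angled = group G for G (structure) +
  fixes I :: "'i set" and s :: "'i \<Rightarrow> 'a" and adj :: "'i \<Rightarrow> 'i \<Rightarrow> bool"
    and val :: "'a \<Rightarrow> 'i \<Rightarrow> int" and par :: "'a \<Rightarrow> 'i \<Rightarrow> bool"
  assumes s_closed [simp, intro]: "i \<in> I \<Longrightarrow> s i \<in> carrier G"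
    and s_square: "i \<in> I \<Longrightarrow> s i \<otimes> s i = \<one>"
    and s_commute: "i \<in> I \<Longrightarrow> j \<in> I \<Longrightarrow> \<not> adj i j \<Longrightarrow> s i \<otimes> s j = s j \<otimes> s i"
    and adj_sym: "adj i j \<Longrightarrow> adj j i"
    and adj_irrefl: "\<not> adj i i"
    and generated: "x \<in> carrier G \<Longrightarrow> \<exists>w. set w \<subseteq> I \<and> x = foldr (\<lambda>i y. s i \<otimes> y) w \<one>"
    and val_one: "i \<in> I \<Longrightarrow> val \<one> i = 1"
    and val_mult: "i \<in> I \<Longrightarrow> j \<in> I \<Longrightarrow> x \<in> carrier G \<Longrightarrow>
      val (s i \<otimes> x) j =
        (if j = i then - val x i else if adj i j then val x j + 2 * val x i else val x j)"
    and par_mult: "i \<in> I \<Longrightarrow> x \<in> carrier G \<Longrightarrow> y \<in> carrier G \<Longrightarrow>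
      par (x \<otimes> y) i = (par x i \<noteq> par y i)"
    and par_s: "i \<in> I \<Longrightarrow> j \<in> I \<Longrightarrow> par (s i) j = (i = j)"
begin

section \<open>Words in the generators and their length\<close>

abbreviation wprod :: "'i list \<Rightarrow> 'a" where
  "wprod w \<equiv> foldr (\<lambda>i y. s i \<otimes> y) w \<one>"

definition len :: "'a \<Rightarrow> nat" where
  "len x = (LEAST k. \<exists>w. set w \<subseteq> I \<and> x = wprod w \<and> length w = k)"

lemma wprod_closed [simp]: "set w \<subseteq> I \<Longrightarrow> wprod w \<in> carrier G"
  by (induction w) auto

lemma wprod_append: "set v \<subseteq> I \<Longrightarrow> set w \<subseteq> I \<Longrightarrow> wprod (v @ w) = wprod v \<otimes> wprod w"
  by (induction v) (auto simp: m_assoc simp del: foldr_append)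

lemma inv_s: "i \<in> I \<Longrightarrow> inv (s i) = s i"
  using s_square by (intro inv_equality) auto

lemma s_cancel [simp]: "i \<in> I \<Longrightarrow> x \<in> carrier G \<Longrightarrow> s i \<otimes> (s i \<otimes> x) = x"
  by (simp add: s_square m_assoc[symmetric])

lemma s_cancel_right [simp]: "i \<in> I \<Longrightarrow> x \<in> carrier G \<Longrightarrow> x \<otimes> s i \<otimes> s i = x"
  by (simp add: s_square m_assoc)

lemma s_commute_left:
  assumes "i \<in> I" "j \<in> I" "\<not> adj i j" "x \<in> carrier G"
  shows "s i \<otimes> (s j \<otimes> x) = s j \<otimes> (s i \<otimes> x)"
proof -
  have "s i \<otimes> s j \<otimes> x = s j \<otimes> s i \<otimes> x"
    by (rule arg_cong[OF s_commute]) (use assms in auto)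
  then show ?thesis using assms by (simp add: m_assoc)
qed

lemma wprod_rev: "set w \<subseteq> I \<Longrightarrow> wprod (rev w) = inv (wprod w)"
proof (induction w)
  case (Cons i w)
  then show ?case
    by (simp add: wprod_append inv_mult_group inv_s del: foldr_append)
qed simp

lemma len_le: "set w \<subseteq> I \<Longrightarrow> len (wprod w) \<le> length w"
  unfolding len_def by (rule Least_le) auto

lemma len_witness:
  assumes "x \<in> carrier G"
  obtains w where "set w \<subseteq> I" "x = wprod w" "length w = len x"
proof -
  obtain w where "set w \<subseteq> I" "x = wprod w" using generated[OF assms] by blast
  then have "\<exists>k w. set w \<subseteq> I \<and> x = wprod w \<and> length w = k" by blast
  from LeastI_ex[OF this] show ?thesis unfolding len_def[symmetric] using that by blast
qed

lemma len_one [simp]: "len \<one> = 0"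
  using len_le[of "[]"] by simp

lemma len_s_le: assumes "i \<in> I" "x \<in> carrier G" shows "len (s i \<otimes> x) \<le> Suc (len x)"
proof -
  obtain w where "set w \<subseteq> I" "x = wprod w" "length w = len x"
    using len_witness assms by blast
  then show ?thesis using len_le[of "i # w"] assms by simp
qed

lemma len_inv_le: assumes "x \<in> carrier G" shows "len (inv x) \<le> len x"
proof -
  obtain w where "set w \<subseteq> I" "x = wprod w" "length w = len x"
    using len_witness assms by blast
  then show ?thesis using len_le[of "rev w"] by (simp add: wprod_rev)
qed

text \<open>Splitting off the first letter of a shortest word leaves a shortest word; this drives
  the inductions on \<open>len\<close> below.\<close>

lemma reduced_cases:
  assumes "x \<in> carrier G"
  obtains (one) "x = \<one>"
  | (step) b u where "b \<in> I" "u \<in> carrier G" "x = s b \<otimes> u" "len x = Suc (len u)"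
proof -
  obtain w where w: "set w \<subseteq> I" "x = wprod w" "length w = len x"
    using len_witness assms by blast
  show ?thesis
  proof (cases w)
    case Nil
    then show ?thesis using w one by simp
  next
    case (Cons b v)
    have "len (wprod v) \<le> length v" using w Cons len_le by simp
    moreover have "len x \<le> Suc (len (wprod v))" using w Cons len_s_le by simp
    ultimately show ?thesis using w Cons by (intro step[of b "wprod v"]) auto
  qed
qed

text \<open>The Cayley graph with edges from \<open>x\<close> to \<open>x \<otimes> s i\<close> is
  connected. Claims about walls thus reduce to single edges.\<close>

lemma right_invariant:
  assumes "\<And>x i. x \<in> carrier G \<Longrightarrow> i \<in> I \<Longrightarrow> F (x \<otimes> s i) = F x"
    and "x \<in> carrier G" "y \<in> carrier G"
  shows "F x = F y"
proof -
  have "F (wprod w) = F \<one>" if "set w \<subseteq> I" for w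
    using that
    by (induction w rule: rev_induct) (simp_all add: wprod_append assms(1) del: foldr_append)
  then show ?thesis using generated[OF assms(2)] generated[OF assms(3)] by metis
qed

section \<open>Signs of labels and descents\<close>

text \<open>A move negates a label or adds an even number to it, so no label ever vanishes.\<close>

lemma val_odd: assumes "x \<in> carrier G" "i \<in> I" shows "odd (val x i)"
proof -
  have "odd (val (wprod w) i)" if "set w \<subseteq> I" for w
    using that \<open>i \<in> I\<close> by (induction w) (auto simp: val_one val_mult)
  then show ?thesis using generated[OF assms(1)] by metis
qed

lemma val_nonzero: "x \<in> carrier G \<Longrightarrow> i \<in> I \<Longrightarrow> val x i \<noteq> 0"
  using val_odd by force

text \<open>For \<open>x = s b \<otimes> u\<close> with \<open>u\<close> shorter, the label of
  \<open>u\<close> at \<open>b\<close> is some p > 0, since otherwise \<open>s b\<close> would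
  shorten \<open>u\<close>. The move replaces p by -p and adds 2p to the neighbours: sums over edges
  at \<open>b\<close> are unchanged and other sums do not drop.\<close>

lemma val_numbers_game:
  assumes "x \<in> carrier G"
  shows "(\<forall>i\<in>I. \<forall>j\<in>I. adj i j \<longrightarrow> val x i + val x j > 0) \<and>
    (\<forall>i\<in>I. val x i < 0 \<longrightarrow> len (s i \<otimes> x) < len x)"
  using assms
proof (induction "len x" arbitrary: x rule: less_induct)
  case less
  from \<open>x \<in> carrier G\<close> show ?case
  proof (cases rule: reduced_cases)
    case one
    then show ?thesis by (simp add: val_one)
  next
    case (step b u)
    have sum: "val u i + val u j > 0" if "i \<in> I" "j \<in> I" "adj i j" for i j
      using less.hyps[of u] step that by simp
    have desc: "len (s i \<otimes> u) < len u" if "i \<in> I" "val u i < 0" for i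
      using less.hyps[of u] step that by simp
    have b: "val u b > 0"
      using desc[of b] step val_nonzero[of u b] by force
    have sum': "val x i + val x j > 0" if "i \<in> I" "j \<in> I" "adj i j" for i j
      using sum[OF that] that b step(1-3) adj_irrefl adj_sym by (auto simp: val_mult)
    \<comment> \<open>Neighbours of \<open>b\<close> have positive labels in \<open>x\<close>, so
      \<open>i\<close> is \<open>b\<close> itself, or \<open>s i\<close> commutes with
      \<open>s b\<close> and already shortens \<open>u\<close>.\<close>
    have "len (s i \<otimes> x) < len x" if i: "i \<in> I" "val x i < 0" for i
    proof (cases "i = b \<or> adj b i")
      case True
      then show ?thesis
        using step sum'[of b i] i b adj_irrefl by (auto simp: val_mult)
    next
      case False
      then have "len (s i \<otimes> u) < len u" using desc i step by (simp add: val_mult)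
      moreover have "s i \<otimes> x = s b \<otimes> (s i \<otimes> u)"
        using False i step adj_sym s_commute_left by metis
      ultimately show ?thesis using len_s_le[of b "s i \<otimes> u"] step i by simp
    qed
    then show ?thesis using sum' by blast
  qed
qed

lemma val_adj:
  "x \<in> carrier G \<Longrightarrow> i \<in> I \<Longrightarrow> j \<in> I \<Longrightarrow> adj i j \<Longrightarrow> val x i < 0 \<Longrightarrow> val x j > 0"
  using val_numbers_game by force

lemma len_descent: "x \<in> carrier G \<Longrightarrow> i \<in> I \<Longrightarrow> val x i < 0 \<Longrightarrow> len (s i \<otimes> x) < len x"
  using val_numbers_game by blast

lemma val_pos_of_reduced:
  assumes "b \<in> I" "u \<in> carrier G" "len (s b \<otimes> u) = Suc (len u)"
  shows "val u b > 0"
  using len_descent[of u b] assms val_nonzero[of u b] by force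

text \<open>The first letter of a shortest word always carries a negative label.\<close>

lemma eq_one_if_val_pos:
  assumes "x \<in> carrier G" "\<And>i. i \<in> I \<Longrightarrow> val x i > 0"
  shows "x = \<one>"
  using assms(1)
proof (cases rule: reduced_cases)
  case (step b u)
  then show ?thesis using val_pos_of_reduced[of b u] assms(2)[of b] by (simp add: val_mult)
qed

lemma s_inject: "i \<in> I \<Longrightarrow> j \<in> I \<Longrightarrow> s i = s j \<Longrightarrow> i = j"
  using par_s by metis

lemma s_not_commute:
  assumes "i \<in> I" "j \<in> I" "adj i j" shows "s i \<otimes> s j \<noteq> s j \<otimes> s i"
proof
  assume eq: "s i \<otimes> s j = s j \<otimes> s i"
  have ij: "i \<noteq> j" "adj j i" using assms adj_irrefl adj_sym by auto
  have "val (s i \<otimes> (s j \<otimes> \<one>)) i = -3" "val (s j \<otimes> (s i \<otimes> \<one>)) i = 5"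
    using assms ij by (simp_all only: val_mult val_one m_closed s_closed one_closed) auto
  then show False using eq assms by simp
qed

section \<open>The exchange condition\<close>

text \<open>An edge from \<open>w\<close> to \<open>w \<otimes> s j\<close> that changes the sign at
  \<open>i\<close> must lie across the wall of \<open>s i\<close>. If the first letter
  \<open>b\<close> of \<open>w\<close> is not adjacent to \<open>i\<close>, it commutes with
  \<open>s i\<close> and can be removed.\<close>

lemma exchange_aux:
  assumes "w \<in> carrier G" "i \<in> I" "j \<in> I" "val w i > 0" "val (w \<otimes> s j) i < 0"
  shows "s i \<otimes> w = w \<otimes> s j"
  using assms(1,2,4,5)
proof (induction "len w" arbitrary: w i rule: less_induct)
  case less
  note j = \<open>j \<in> I\<close> and i = \<open>i \<in> I\<close>
  from \<open>w \<in> carrier G\<close> show ?case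
  proof (cases rule: reduced_cases)
    case one
    have "val (s j) i < 0" using less.prems one j by simp
    then have "i = j"
      using i j val_mult[of j i \<one>] by (auto simp: val_one split: if_splits)
    then show ?thesis using one j by simp
  next
    case (step b u)
    have b: "val u b > 0" using val_pos_of_reduced step by auto
    have wb: "val w b < 0" using step b by (simp add: val_mult)
    then have "b \<noteq> i" using less.prems by auto
    have ws: "w \<otimes> s j = s b \<otimes> (u \<otimes> s j)" using step j by (simp add: m_assoc)
    show ?thesis
    proof (cases "adj b i")
      case False
      have "val u i > 0" "val (u \<otimes> s j) i < 0"
        using less.prems ws step False \<open>b \<noteq> i\<close> i j by (auto simp: val_mult)
      then have eq: "s i \<otimes> u = u \<otimes> s j" using less.hyps[of u i] step i by simp
      have "s i \<otimes> w = s b \<otimes> (s i \<otimes> u)"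
        using s_commute_left[of b i u] False i step by simp
      then show ?thesis using eq ws by simp
    next
      case True
      \<comment> \<open>Adjacent labels are not both negative, so the sign at \<open>b\<close>
        changes too and \<open>w = u \<otimes> s j\<close>. The induction hypothesis for
        \<open>s i \<otimes> u\<close> then yields \<open>s i \<otimes> u = s b \<otimes> u\<close>,
        a contradiction.\<close>
      have "val (w \<otimes> s j) b > 0"
        using less.prems True adj_sym val_adj[of "w \<otimes> s j" i b] step j by simp
      then have "val (u \<otimes> s j) b < 0" using ws step j by (simp add: val_mult)
      then have "s b \<otimes> u = u \<otimes> s j" using less.hyps[of u b] step b by simp
      then have w: "w = u \<otimes> s j" using step by simp
      then have u: "w \<otimes> s j = u" using step j by simp
      define v where "v = s i \<otimes> u"
      have v: "v \<in> carrier G" "len v < len w"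
        using len_descent[of u i] less.prems u step i by (auto simp: v_def)
      have "val v i > 0" using less.prems u step i by (simp add: v_def val_mult)
      moreover have "v \<otimes> s j = s i \<otimes> w" using w step i j by (simp add: v_def m_assoc)
      then have "val (v \<otimes> s j) i < 0" using less.prems i by (simp add: val_mult)
      ultimately have "s i \<otimes> v = v \<otimes> s j" using less.hyps[of v i] v i by simp
      then have "u = s i \<otimes> w" using \<open>v \<otimes> s j = s i \<otimes> w\<close> step i by (simp add: v_def)
      then have "s i \<otimes> u = w" using s_cancel i less.prems by metis
      then have "s i = s b" using step i right_cancel[of u "s i" "s b"] by simp
      then show ?thesis using s_inject i \<open>b \<in> I\<close> \<open>b \<noteq> i\<close> by blast
    qed
  qed
qed

lemma exchange:
  assumes "w \<in> carrier G" "i \<in> I" "j \<in> I" "(val w i > 0) \<noteq> (val (w \<otimes> s j) i > 0)"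
  shows "s i \<otimes> w = w \<otimes> s j"
proof (cases "val w i > 0")
  case True
  then show ?thesis using exchange_aux assms val_nonzero[of "w \<otimes> s j" i] by auto
next
  case False
  then have "s i \<otimes> (w \<otimes> s j) = w \<otimes> s j \<otimes> s j"
    using exchange_aux[of "w \<otimes> s j" i j] assms val_nonzero[of w i] by auto
  then have "s i \<otimes> (s i \<otimes> (w \<otimes> s j)) = s i \<otimes> w" using assms by simp
  then show ?thesis using assms by simp
qed

section \<open>Involutions\<close>

text \<open>The property forces \<open>x\<close> to be a product of distinct, pairwise commuting
  generators; the next lemmas express this through labels and parities.\<close>

definition descents_central :: "'a \<Rightarrow> bool" where
  "descents_central x \<longleftrightarrow> (\<forall>i\<in>I. val x i < 0 \<longrightarrow> s i \<otimes> x = x \<otimes> s i)"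

text \<open>Because \<open>x\<close> commutes with \<open>s b\<close>, the elements
  \<open>s b \<otimes> x\<close> and \<open>x\<close> are joined by an edge of type
  \<open>b\<close>. If it changed the sign at a neighbour \<open>c\<close> of \<open>b\<close>,
  exchange would give \<open>s c = s b\<close>.\<close>

lemma descents_central_step:
  assumes x: "x \<in> carrier G" "descents_central x" and b: "b \<in> I" "val x b < 0"
  shows "descents_central (s b \<otimes> x)"
    and "c \<in> I \<Longrightarrow> adj b c \<Longrightarrow> val (s b \<otimes> x) c > 0"
proof -
  let ?u = "s b \<otimes> x"
  have sx: "s b \<otimes> x = x \<otimes> s b" using x b by (simp add: descents_central_def)
  have us: "?u \<otimes> s b = x" using sx x b by simp
  show pos: "val ?u c > 0" if c: "c \<in> I" "adj b c" for c
  proof (rule ccontr)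
    assume "\<not> val ?u c > 0"
    moreover have "val x c > 0" using val_adj x b c by blast
    ultimately have "s c \<otimes> ?u = s b \<otimes> ?u"
      using exchange[of ?u c b] us x b c by simp
    then have "s c = s b" using x b c right_cancel[of ?u "s c" "s b"] m_closed s_closed by blast
    then have "c = b" using s_inject b c by simp
    then show False using c adj_irrefl by simp
  qed
  show "descents_central ?u"
    unfolding descents_central_def
  proof (intro ballI impI)
    fix c assume c: "c \<in> I" "val ?u c < 0"
    then have "\<not> adj b c" using pos by force
    moreover have "c \<noteq> b" using c b x by (auto simp: val_mult)
    ultimately have "s c \<otimes> x = x \<otimes> s c"
      using c x b by (simp add: val_mult descents_central_def)
    then show "s c \<otimes> ?u = ?u \<otimes> s c"
      using s_commute_left[of b c x] \<open>\<not> adj b c\<close> b c x by (simp add: m_assoc)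
  qed
qed

text \<open>Removing the letter \<open>b\<close> flips both sign and parity at \<open>b\<close>.
  Labels at neighbours of \<open>b\<close> are positive before and after, and all others stay the
  same.\<close>

lemma descent_iff_par:
  assumes "x \<in> carrier G" "descents_central x" "i \<in> I"
  shows "val x i < 0 \<longleftrightarrow> par x i"
  using assms
proof (induction "len x" arbitrary: x rule: less_induct)
  case less
  from \<open>x \<in> carrier G\<close> show ?case
  proof (cases rule: reduced_cases)
    case one
    then show ?thesis using par_mult[of i \<one> \<one>] \<open>i \<in> I\<close> by (simp add: val_one)
  next
    case (step b u)
    have "val u b > 0" using val_pos_of_reduced step by auto
    then have b: "val x b < 0" using step by (simp add: val_mult)
    have u: "s b \<otimes> x = u" using step by simp
    have "descents_central u" and adj_pos: "adj b i \<Longrightarrow> val u i > 0"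
      using descents_central_step(1)[OF less.prems(1,2) \<open>b \<in> I\<close> b]
        descents_central_step(2)[OF less.prems(1,2) \<open>b \<in> I\<close> b less.prems(3)]
      by (simp_all only: u)
    then have IH: "val u i < 0 \<longleftrightarrow> par u i" using less.hyps[of u] less.prems step by simp
    have "par x i \<longleftrightarrow> (b = i) \<noteq> par u i" using step less.prems by (simp add: par_mult par_s)
    moreover have "val x i > 0" if "adj b i" using val_adj that b less.prems step by blast
    ultimately show ?thesis
      using IH adj_pos b \<open>val u b > 0\<close> step(1-3) less.prems adj_irrefl
      by (cases "adj b i"; cases "b = i") (auto simp: val_mult)
  qed
qed

lemma eq_generator_if_descents_central:
  assumes x: "x \<in> carrier G" "descents_central x" and i: "i \<in> I"
    and par: "\<And>j. j \<in> I \<Longrightarrow> par x j \<longleftrightarrow> i = j"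
  shows "x = s i"
proof -
  let ?u = "s i \<otimes> x"
  have "val x i < 0" using descent_iff_par x i par by simp
  then have "descents_central ?u" using descents_central_step(1) x i by blast
  \<comment> \<open>All parities of \<open>?u\<close> are even, so it has no descents.\<close>
  then have "val ?u j > 0" if "j \<in> I" for j
    using descent_iff_par[of ?u j] par[OF that] that x i val_nonzero[of ?u j]
    by (force simp: par_mult par_s)
  then have "?u = \<one>" using eq_one_if_val_pos x i by simp
  then have "s i \<otimes> ?u = s i" using i by simp
  then show ?thesis using x i by simp
qed

section \<open>Reflections\<close>

definition reflection :: "'a \<Rightarrow> 'i \<Rightarrow> 'a" where
  "reflection g i = g \<otimes> s i \<otimes> inv g"

lemma reflection_closed [simp]: "g \<in> carrier G \<Longrightarrow> i \<in> I \<Longrightarrow> reflection g i \<in> carrier G"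
  by (simp add: reflection_def)

lemma inv_cancel_left [simp]: "g \<in> carrier G \<Longrightarrow> x \<in> carrier G \<Longrightarrow> inv g \<otimes> (g \<otimes> x) = x"
  by (simp add: m_assoc[symmetric])

lemma inv_cancel_left' [simp]: "g \<in> carrier G \<Longrightarrow> x \<in> carrier G \<Longrightarrow> g \<otimes> (inv g \<otimes> x) = x"
  by (simp add: m_assoc[symmetric])

lemma par_conj:
  assumes "g \<in> carrier G" "x \<in> carrier G" "i \<in> I"
  shows "par (g \<otimes> x \<otimes> inv g) i = par x i"
proof -
  have "par (g \<otimes> x \<otimes> inv g \<otimes> g) i = par (g \<otimes> x) i" using assms by (simp add: m_assoc)
  then show ?thesis using assms by (simp add: par_mult del: inv_solve_right) blast
qed

lemma par_reflection: "g \<in> carrier G \<Longrightarrow> i \<in> I \<Longrightarrow> j \<in> I \<Longrightarrow> par (reflection g i) j = (i = j)"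
  by (simp add: reflection_def par_conj par_s)

text \<open>An involution whose length cannot be decreased by conjugation commutes with its descents.\<close>

lemma involution_is_reflection:
  assumes "t \<in> carrier G" "t \<otimes> t = \<one>" "i \<in> I" "\<And>j. j \<in> I \<Longrightarrow> par t j \<longleftrightarrow> i = j"
  shows "\<exists>g\<in>carrier G. t = reflection g i"
  using assms(1,2,4)
proof (induction "len t" arbitrary: t rule: less_induct)
  case less
  show ?case
  proof (cases "descents_central t")
    case True
    then have "t = reflection \<one> i"
      using eq_generator_if_descents_central less.prems assms(3) by (simp add: reflection_def)
    then show ?thesis by blast
  next
    case False
    then obtain b where b: "b \<in> I" "val t b < 0" "s b \<otimes> t \<noteq> t \<otimes> s b"
      unfolding descents_central_def by blast
    have t: "t \<in> carrier G" "inv t = t" using less.prems by (auto intro: inv_equality)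
    let ?t = "s b \<otimes> t \<otimes> s b"
    \<comment> \<open>\<open>t \<otimes> s b\<close> is the inverse of
      \<open>s b \<otimes> t\<close>.\<close>
    have "len (t \<otimes> s b) \<le> len (s b \<otimes> t)"
      using len_inv_le[of "s b \<otimes> t"] b t by (simp add: inv_mult_group inv_s)
    also have "\<dots> < len t" using len_descent b t by blast
    finally have "len (t \<otimes> s b) < len t" .
    \<comment> \<open>A sign change at \<open>b\<close> between \<open>t\<close> and
      \<open>t \<otimes> s b\<close> would make \<open>s b\<close> commute with \<open>t\<close>.
      Hence multiplying by \<open>s b\<close> shortens on either side.\<close>
    moreover have "val (t \<otimes> s b) b < 0"
      using exchange[of t b b] b t val_nonzero[of "t \<otimes> s b" b] by force
    then have "len ?t < len (t \<otimes> s b)"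
      using len_descent[of "t \<otimes> s b" b] b t by (simp add: m_assoc)
    ultimately have "len ?t < len t" by simp
    moreover have "?t \<otimes> ?t = s b \<otimes> (t \<otimes> (s b \<otimes> (s b \<otimes> (t \<otimes> s b))))"
      using b t by (simp add: m_assoc del: s_cancel)
    then have "?t \<otimes> ?t = \<one>" using b t less.prems by (simp add: s_square m_assoc[symmetric])
    moreover have "par ?t j \<longleftrightarrow> i = j" if "j \<in> I" for j
      using par_conj[of "s b" t j] b t that less.prems by (simp add: inv_s)
    ultimately obtain g where g: "g \<in> carrier G" "?t = reflection g i"
      using less.hyps[of ?t] b t by auto
    have "t = s b \<otimes> (?t \<otimes> s b)" using b t by (simp add: m_assoc s_square)
    also have "\<dots> = reflection (s b \<otimes> g) i"
      using g b assms(3) by (simp add: reflection_def inv_mult_group inv_s m_assoc)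
    finally show ?thesis using g b by blast
  qed
qed

section \<open>Half-spaces\<close>

text \<open>This is the half-space containing \<open>g\<close> whose wall belongs to
  \<open>reflection g i\<close>. The pair records an orientation: \<open>g \<otimes> s i\<close>
  gives the same wall and the opposite half-space.\<close>

definition side :: "'a \<Rightarrow> 'i \<Rightarrow> 'a \<Rightarrow> bool" where
  "side g i x \<longleftrightarrow> val (inv g \<otimes> x) i > 0"

lemma side_self: "g \<in> carrier G \<Longrightarrow> i \<in> I \<Longrightarrow> side g i g"
  by (simp add: side_def val_one)

lemma side_one: "x \<in> carrier G \<Longrightarrow> side \<one> i x \<longleftrightarrow> val x i > 0"
  by (simp add: side_def)

lemma side_translate:
  "g \<in> carrier G \<Longrightarrow> h \<in> carrier G \<Longrightarrow> x \<in> carrier G \<Longrightarrow> side (h \<otimes> g) i x \<longleftrightarrow> side g i (inv h \<otimes> x)"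
  by (simp add: side_def inv_mult_group m_assoc)

lemma val_s_pos_iff:
  "i \<in> I \<Longrightarrow> x \<in> carrier G \<Longrightarrow> val (s i \<otimes> x) i > 0 \<longleftrightarrow> \<not> val x i > 0"
  using val_nonzero[of x i] by (auto simp: val_mult)

lemma side_reflect:
  "g \<in> carrier G \<Longrightarrow> i \<in> I \<Longrightarrow> x \<in> carrier G \<Longrightarrow>
    side g i (reflection g i \<otimes> x) \<longleftrightarrow> \<not> side g i x"
  by (simp add: side_def reflection_def m_assoc val_s_pos_iff)

lemma reflection_flip: "g \<in> carrier G \<Longrightarrow> i \<in> I \<Longrightarrow> reflection (g \<otimes> s i) i = reflection g i"
  by (simp add: reflection_def inv_mult_group inv_s m_assoc)

lemma side_flip:
  "g \<in> carrier G \<Longrightarrow> i \<in> I \<Longrightarrow> x \<in> carrier G \<Longrightarrow> side (g \<otimes> s i) i x \<longleftrightarrow> \<not> side g i x"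
  by (simp add: side_def inv_mult_group inv_s m_assoc val_s_pos_iff)

lemma reflection_orient:
  assumes "g \<in> carrier G" "i \<in> I"
  obtains h where "h \<in> carrier G" "reflection h i = reflection g i"
    "\<And>x. x \<in> carrier G \<Longrightarrow> side h i x \<longleftrightarrow> side g i x = a"
proof (cases a)
  case True
  then show ?thesis using assms that[of g] by simp
next
  case False
  then show ?thesis using assms that[of "g \<otimes> s i"] by (simp add: reflection_flip side_flip)
qed

lemma reflection_mult: "x \<in> carrier G \<Longrightarrow> k \<in> I \<Longrightarrow> reflection x k \<otimes> x = x \<otimes> s k"
  by (simp add: reflection_def m_assoc)

lemma reflection_eqI:
  assumes "x \<in> carrier G" "k \<in> I" "r \<in> carrier G" "r \<otimes> x = x \<otimes> s k"
  shows "r = reflection x k"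
  using assms reflection_mult[of x k] right_cancel[of x r "reflection x k"] by simp

text \<open>Translation by \<open>inv g\<close> turns this into the exchange condition: an edge
  crosses exactly one wall.\<close>

lemma side_cross_iff:
  assumes "g \<in> carrier G" "i \<in> I" "x \<in> carrier G" "k \<in> I"
  shows "side g i (x \<otimes> s k) \<noteq> side g i x \<longleftrightarrow> reflection g i = reflection x k"
proof
  assume "side g i (x \<otimes> s k) \<noteq> side g i x"
  then have "s i \<otimes> (inv g \<otimes> x) = inv g \<otimes> x \<otimes> s k"
    using exchange[of "inv g \<otimes> x" i k] assms by (auto simp: side_def m_assoc)
  then have "g \<otimes> (s i \<otimes> (inv g \<otimes> x)) = g \<otimes> (inv g \<otimes> x \<otimes> s k)" by simp
  then have "reflection g i \<otimes> x = x \<otimes> s k" using assms by (simp add: reflection_def m_assoc)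
  then show "reflection g i = reflection x k" using reflection_eqI assms by simp
next
  assume "reflection g i = reflection x k"
  then have "x \<otimes> s k = reflection g i \<otimes> x" using reflection_mult assms by simp
  then show "side g i (x \<otimes> s k) \<noteq> side g i x" using side_reflect assms by simp
qed

text \<open>Every edge crosses both walls or neither, so a reflection determines its half-spaces up
  to orientation.\<close>

lemma side_determined_by_reflection:
  assumes "g \<in> carrier G" "i \<in> I" "h \<in> carrier G" "j \<in> I" "reflection g i = reflection h j"
    and "x \<in> carrier G" "y \<in> carrier G"
  shows "side g i x = side h j x \<longleftrightarrow> side g i y = side h j y"
proof (rule right_invariant[where F = "\<lambda>x. side g i x = side h j x"])
  fix x k assume "x \<in> carrier G" "k \<in> I"
  then show "(side g i (x \<otimes> s k) = side h j (x \<otimes> s k)) = (side g i x = side h j x)"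
    using side_cross_iff[of g i x k] side_cross_iff[of h j x k] assms by auto
qed (use assms in auto)

text \<open>By commutation, \<open>reflection h j\<close> maps edges across the wall of
  \<open>reflection g i\<close> to such edges, so it preserves the two sides everywhere or swaps
  them everywhere. It sends \<open>h\<close> to \<open>h \<otimes> s j\<close>, along an edge that
  crosses only its own wall.\<close>

lemma side_invariant:
  assumes g: "g \<in> carrier G" "i \<in> I" and h: "h \<in> carrier G" "j \<in> I"
    and comm: "reflection g i \<otimes> reflection h j = reflection h j \<otimes> reflection g i"
    and ne: "reflection g i \<noteq> reflection h j" and x: "x \<in> carrier G"
  shows "side g i (reflection h j \<otimes> x) = side g i x"
proof -
  let ?r = "reflection g i" and ?t = "reflection h j"
  have t: "?t \<in> carrier G" using h by simp
  have "(side g i (?t \<otimes> x) = side g i x) = (side g i (?t \<otimes> h) = side g i h)"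
  proof (rule right_invariant[where F = "\<lambda>x. side g i (?t \<otimes> x) = side g i x"])
    fix x k assume x: "x \<in> carrier G" "k \<in> I"
    have "?r = reflection (?t \<otimes> x) k \<longleftrightarrow> ?r \<otimes> (?t \<otimes> x) = ?t \<otimes> x \<otimes> s k"
      using reflection_eqI[of "?t \<otimes> x" k ?r] reflection_mult[of "?t \<otimes> x" k] x t g by auto
    also have "\<dots> \<longleftrightarrow> ?t \<otimes> (?r \<otimes> x) = ?t \<otimes> (x \<otimes> s k)"
      using comm x t g by (simp add: m_assoc[symmetric])
    also have "\<dots> \<longleftrightarrow> ?r = reflection x k"
      using reflection_eqI[of x k ?r] reflection_mult[of x k] x t g by auto
    finally show "(side g i (?t \<otimes> (x \<otimes> s k)) = side g i (x \<otimes> s k))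
        = (side g i (?t \<otimes> x) = side g i x)"
      using side_cross_iff[of g i x k] side_cross_iff[of g i "?t \<otimes> x" k] x g t
      by (auto simp: m_assoc)
  qed (use x h in auto)
  then show ?thesis
    using side_cross_iff[of g i h j] reflection_mult[of h j] g h ne by simp
qed

section \<open>Crossing and non-crossing walls\<close>

text \<open>Reflect to the wanted side of the first wall, then of the second; the second reflection
  preserves the sides of the first wall.\<close>

lemma quadrant_nonempty:
  assumes g: "g \<in> carrier G" "i \<in> I" and h: "h \<in> carrier G" "j \<in> I"
    and comm: "reflection g i \<otimes> reflection h j = reflection h j \<otimes> reflection g i"
    and ne: "reflection g i \<noteq> reflection h j"
  shows "\<exists>x\<in>carrier G. side g i x = a \<and> side h j x = b"
proof -
  let ?r = "reflection g i" and ?t = "reflection h j"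
  define y where "y = (if side g i \<one> = a then \<one> else ?r)"
  have y: "y \<in> carrier G" "side g i y = a"
    using g side_reflect[of g i \<one>] by (auto simp: y_def)
  define x where "x = (if side h j y = b then y else ?t \<otimes> y)"
  have "x \<in> carrier G" "side g i x = a" "side h j x = b"
    using y h side_reflect[of h j y] side_invariant[OF g h comm ne y(1)] by (auto simp: x_def)
  then show ?thesis by blast
qed

text \<open>Walls of non-commuting reflections do not cross. The induction strips letters from
  \<open>h\<close> and transports the empty quadrant back; it starts from two adjacent labels, which
  are never both negative.\<close>

lemma empty_quadrant_base:
  assumes "h \<in> carrier G" "i \<in> I" "j \<in> I"
    and "s i \<otimes> reflection h j \<noteq> reflection h j \<otimes> s i"
  shows "\<exists>a c. \<forall>x\<in>carrier G. \<not> ((val x i > 0) = a \<and> side h j x = c)"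
  using assms(1,2,4)
proof (induction "len h" arbitrary: h i rule: less_induct)
  case less
  note i = \<open>i \<in> I\<close> and j = \<open>j \<in> I\<close>
  from \<open>h \<in> carrier G\<close> show ?case
  proof (cases rule: reduced_cases)
    case one
    then have "adj i j" using less.prems s_commute[of i j] j by (auto simp: reflection_def)
    then have "\<forall>x\<in>carrier G. \<not> ((val x i > 0) = False \<and> side h j x = False)"
      using val_adj one i j val_nonzero by (force simp: side_one not_less order_le_less)
    then show ?thesis by blast
  next
    case (step b u)
    note b = \<open>b \<in> I\<close> and u = \<open>u \<in> carrier G\<close>
    let ?t = "reflection u j"
    have t: "?t \<in> carrier G" using u j by simp
    have side_h: "side h j x = side u j (s b \<otimes> x)" if "x \<in> carrier G" for x
      using side_translate[of u "s b" x j] that b u step inv_s by simp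
    have refl_h: "reflection h j = s b \<otimes> ?t \<otimes> s b"
      using step b u j by (simp add: reflection_def inv_mult_group inv_s m_assoc)
    have IH: "\<exists>a c. \<forall>x\<in>carrier G. \<not> ((val x k > 0) = a \<and> side u j x = c)"
      if "k \<in> I" "s k \<otimes> ?t \<noteq> ?t \<otimes> s k" for k
      using less.hyps[of u k] step that by simp
    show ?thesis
    proof (cases "adj b i")
      case False
      have comm: "s i \<otimes> s b = s b \<otimes> s i" using s_commute[of b i] False b i by simp
      have "s i \<otimes> ?t \<noteq> ?t \<otimes> s i"
      proof
        assume eq: "s i \<otimes> ?t = ?t \<otimes> s i"
        have "s i \<otimes> (s b \<otimes> ?t \<otimes> s b) = (s i \<otimes> s b) \<otimes> ?t \<otimes> s b"
          using b i t by (simp add: m_assoc)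
        also have "\<dots> = s b \<otimes> (s i \<otimes> ?t) \<otimes> s b" using comm b i t by (simp add: m_assoc)
        also have "\<dots> = s b \<otimes> ?t \<otimes> (s i \<otimes> s b)" using eq b i t by (simp add: m_assoc)
        also have "\<dots> = s b \<otimes> ?t \<otimes> s b \<otimes> s i" using comm b i t by (simp add: m_assoc)
        finally show False using less.prems refl_h by simp
      qed
      then obtain a c where ac: "\<forall>x\<in>carrier G. \<not> ((val x i > 0) = a \<and> side u j x = c)"
        using IH i by blast
      have "val (s b \<otimes> x) i > 0 \<longleftrightarrow> (val x i > 0) \<noteq> (b = i)" if "x \<in> carrier G" for x
        using that False b i val_s_pos_iff[of i x] by (auto simp: val_mult)
      then have "\<forall>x\<in>carrier G. \<not> ((val x i > 0) = (a \<noteq> (b = i)) \<and> side h j x = c)"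
        using ac side_h b by (metis m_closed s_closed)
      then show ?thesis by blast
    next
      case True
      show ?thesis
      proof (cases "s b \<otimes> ?t = ?t \<otimes> s b")
        case comm: True
        then have "reflection h j = ?t" using refl_h b t by simp
        then have "s i \<otimes> ?t \<noteq> ?t \<otimes> s i" using less.prems by simp
        then obtain a c where ac: "\<forall>x\<in>carrier G. \<not> ((val x i > 0) = a \<and> side u j x = c)"
          using IH i by blast
        have sb: "reflection \<one> b = s b" using b by (simp add: reflection_def)
        \<comment> \<open>\<open>s b\<close> either equals \<open>?t\<close> and swaps its sides, or
          is a different reflection commuting with it and preserves them.\<close>
        have "side h j x \<longleftrightarrow> side u j x \<noteq> (s b = ?t)" if "x \<in> carrier G" for x
          using side_h that side_reflect[of u j x] side_invariant[of u j \<one> b x] sb comm b u j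
          by auto
        then have "\<forall>x\<in>carrier G. \<not> ((val x i > 0) = a \<and> side h j x = (c \<noteq> (s b = ?t)))"
          using ac by blast
        then show ?thesis by blast
      next
        case ncomm: False
        then obtain a c where ac: "\<forall>x\<in>carrier G. \<not> ((val x b > 0) = a \<and> side u j x = c)"
          using IH b by blast
        \<comment> \<open>\<open>u\<close> and \<open>u \<otimes> s j\<close> are separated by the
          wall of \<open>?t\<close>, but both have a positive label at \<open>b\<close>. So the
          empty quadrant lies on the negative side of \<open>b\<close>.\<close>
        have "val u b > 0" using val_pos_of_reduced step by auto
        moreover have "val (u \<otimes> s j) b > 0"
        proof (rule ccontr)
          assume "\<not> val (u \<otimes> s j) b > 0"
          then have "s b \<otimes> u = u \<otimes> s j" using exchange[of u b j] calculation b u j by simp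
          then have "s b = ?t" using reflection_eqI b u j by simp
          then show False using ncomm by simp
        qed
        moreover have "side u j u" "\<not> side u j (u \<otimes> s j)"
          using side_self[of u j] side_cross_iff[of u j u j] u j by auto
        ultimately have "\<not> a" using ac u j by (metis m_closed s_closed)
        \<comment> \<open>Translated by \<open>s b\<close>, the empty quadrant shows that points on
          side \<open>c\<close> have a negative label at \<open>b\<close>, hence a positive one at
          its neighbour \<open>i\<close>.\<close>
        have "\<not> ((val x i > 0) = False \<and> side h j x = c)" if x: "x \<in> carrier G" for x
        proof
          assume *: "(val x i > 0) = False \<and> side h j x = c"
          then have "val (s b \<otimes> x) b > 0" using ac side_h \<open>\<not> a\<close> x b by (metis m_closed s_closed)
          then have "val x b < 0" using x b by (simp add: val_mult)
          then show False using * val_adj[of x b i] True x b i by simp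
        qed
        then show ?thesis by blast
      qed
    qed
  qed
qed

lemma empty_quadrant:
  assumes g: "g \<in> carrier G" "i \<in> I" and h: "h \<in> carrier G" "j \<in> I"
    and ncomm: "reflection g i \<otimes> reflection h j \<noteq> reflection h j \<otimes> reflection g i"
  obtains a c where "\<And>x. x \<in> carrier G \<Longrightarrow> \<not> (side g i x = a \<and> side h j x = c)"
proof -
  let ?h = "inv g \<otimes> h"
  let ?t = "reflection ?h j"
  have t: "?t \<in> carrier G" using g h by simp
  have rh: "reflection h j = g \<otimes> ?t \<otimes> inv g"
    using g h by (simp add: reflection_def inv_mult_group m_assoc)
  have "s i \<otimes> ?t \<noteq> ?t \<otimes> s i"
  proof
    assume eq: "s i \<otimes> ?t = ?t \<otimes> s i"
    have "reflection g i \<otimes> reflection h j = g \<otimes> (s i \<otimes> ?t) \<otimes> inv g"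
      unfolding rh reflection_def[of g i] using g t by (simp add: m_assoc)
    also have "\<dots> = reflection h j \<otimes> reflection g i"
      unfolding rh reflection_def[of g i] eq using g t by (simp add: m_assoc)
    finally show False using ncomm by simp
  qed
  then obtain a c where "\<forall>x\<in>carrier G. \<not> ((val x i > 0) = a \<and> side ?h j x = c)"
    using empty_quadrant_base[of ?h i j] g h by auto
  moreover have "side h j x = side ?h j (inv g \<otimes> x)" if "x \<in> carrier G" for x
    using side_translate[of ?h g x j] g h that by simp
  ultimately show ?thesis using that[of a c] g by (metis inv_closed m_closed side_def)
qed

section \<open>Convexity of half-spaces\<close>

text \<open>Take a negative label \<open>j\<close> of \<open>inv a \<otimes> b\<close>. The wall
  crossed by the edge to \<open>a \<otimes> s j\<close> separates \<open>a\<close> from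
  \<open>b\<close>, so no half-space containing both is left.\<close>

lemma convex_step:
  assumes "a \<in> carrier G" "b \<in> carrier G" "a \<noteq> b"
  obtains j where "j \<in> I" "len (inv (a \<otimes> s j) \<otimes> b) < len (inv a \<otimes> b)"
    "\<And>g i. g \<in> carrier G \<Longrightarrow> i \<in> I \<Longrightarrow> side g i a = side g i b \<Longrightarrow> side g i (a \<otimes> s j) = side g i a"
proof -
  let ?w = "inv a \<otimes> b"
  have "?w \<noteq> \<one>" using assms by (metis inv_cancel_left' inv_closed r_one)
  then obtain j where j: "j \<in> I" "\<not> val ?w j > 0" using eq_one_if_val_pos assms by blast
  have neg: "val ?w j < 0" using j val_nonzero[of ?w j] assms by simp
  have "inv (a \<otimes> s j) \<otimes> b = s j \<otimes> ?w" using assms j by (simp add: inv_mult_group inv_s m_assoc)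
  then have "len (inv (a \<otimes> s j) \<otimes> b) < len ?w" using len_descent neg j assms by simp
  moreover have "side g i (a \<otimes> s j) = side g i a"
    if g: "g \<in> carrier G" "i \<in> I" "side g i a = side g i b" for g i
  proof (rule ccontr)
    assume "side g i (a \<otimes> s j) \<noteq> side g i a"
    then have "reflection g i = reflection a j" using side_cross_iff assms g j by blast
    then have "side g i a = side a j a \<longleftrightarrow> side g i b = side a j b"
      using side_determined_by_reflection g assms j by blast
    moreover have "side a j a" "\<not> side a j b" using side_self assms j by (auto simp: side_def)
    ultimately show False using g by simp
  qed
  ultimately show ?thesis using that j by blast
qed

text \<open>A walk from \<open>a\<close> that keeps approaching \<open>b\<close> stays in all
  half-spaces of the family \<open>F\<close>, and some edge of it crosses the wall of
  \<open>reflection h k\<close>.\<close>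

lemma convex_crossing:
  assumes "a \<in> carrier G" "b \<in> carrier G" "side h k a \<noteq> side h k b" "h \<in> carrier G" "k \<in> I"
    and F: "\<And>g i. (g, i) \<in> F \<Longrightarrow> g \<in> carrier G \<and> i \<in> I"
    and "\<And>g i. (g, i) \<in> F \<Longrightarrow> side g i a \<and> side g i b"
  shows "\<exists>x\<in>carrier G. \<exists>j\<in>I. (\<forall>(g, i)\<in>F. side g i x \<and> side g i (x \<otimes> s j)) \<and>
    side h k x = side h k a \<and> side h k (x \<otimes> s j) = side h k b"
  using assms(1,3,7)
proof (induction "len (inv a \<otimes> b)" arbitrary: a rule: less_induct)
  case less
  then have "a \<noteq> b" by auto
  from convex_step[OF less.prems(1) assms(2) this] obtain j where
    j: "j \<in> I" "len (inv (a \<otimes> s j) \<otimes> b) < len (inv a \<otimes> b)"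
    and conv: "\<And>g i. g \<in> carrier G \<Longrightarrow> i \<in> I \<Longrightarrow> side g i a = side g i b \<Longrightarrow>
      side g i (a \<otimes> s j) = side g i a" by blast
  have F': "side g i (a \<otimes> s j)" if "(g, i) \<in> F" for g i
    using conv[of g i] F that less.prems by blast
  show ?case
  proof (cases "side h k (a \<otimes> s j) = side h k a")
    case False
    then have "side h k (a \<otimes> s j) = side h k b" using less.prems(2) by auto
    then show ?thesis using j less.prems F' by blast
  next
    case True
    then show ?thesis using less.hyps[of "a \<otimes> s j"] j less.prems F' by auto
  qed
qed

lemma generator_induct [consumes 1, case_names one mult]:
  assumes "x \<in> carrier G" "P \<one>"
    and "\<And>i y. i \<in> I \<Longrightarrow> y \<in> carrier G \<Longrightarrow> P y \<Longrightarrow> P (s i \<otimes> y)"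
  shows "P x"
proof -
  have "P (wprod w)" if "set w \<subseteq> I" for w
    using that assms by (induction w) auto
  then show ?thesis using generated[OF assms(1)] by blast
qed

section \<open>Parity and the abelianization\<close>

text \<open>Parity is a homomorphism to an abelian group, so it is trivial on commutators.\<close>

lemma par_derived:
  assumes "x \<in> derived G (carrier G)" "i \<in> I" shows "\<not> par x i"
proof -
  have one: "\<not> par \<one> i" using par_mult[of i \<one> \<one>] assms by simp
  have par_inv: "par (inv x) i = par x i" if "x \<in> carrier G" for x
    using par_mult[of i x "inv x"] that assms one by simp
  have comm: "\<not> par x i" if "x \<in> derived_set G (carrier G)" for x
    using that assms by (auto simp: par_mult par_inv)
  have sub: "derived_set G (carrier G) \<subseteq> carrier G" by auto
  show ?thesis
    using assms(1) unfolding derived_def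
  proof (induction rule: generate.induct)
    case (eng h1 h2)
    then show ?case using generate_in_carrier[OF sub] by (simp add: par_mult assms)
  next
    case (inv h)
    then have "h \<in> carrier G" using sub by blast
    then show ?case using comm[OF inv] par_inv by simp
  qed (use one comm in auto)
qed

lemma par_IA_automorphism:
  assumes "\<phi> \<in> IA_automorphisms G" "x \<in> carrier G" "i \<in> I"
  shows "par (\<phi> x) i = par x i"
proof -
  let ?D = "derived G (carrier G)"
  have D: "?D \<subseteq> carrier G" "subgroup ?D G"
    using derived_in_carrier derived_is_subgroup by auto
  have "?D #> x \<in> carrier (abelianization G)"
    using assms(2) by (auto simp: abelianization_def FactGroup_def RCOSETS_def)
  then have "\<phi> ` (?D #> x) = ?D #> x" using assms(1) by (auto simp: IA_automorphisms_def)
  then have "\<phi> x \<in> ?D #> x" using rcos_self[OF assms(2) D(2)] by blast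
  then obtain d where "d \<in> ?D" "\<phi> x = d \<otimes> x" by (auto simp: r_coset_def)
  then show ?thesis using par_derived assms D by (auto simp: par_mult)
qed

end

section \<open>Automorphisms fixing the abelianization\<close>

text \<open>Of the IA property only the effect on parities is kept; \<open>m\<close> stands for n -
  1.\<close>

locale path_right_angled = right_angled G "{1..m}" s "\<lambda>i j. j = Suc i \<or> i = Suc j" val par
  for G (structure) and m :: nat and s val par +
  fixes \<phi> :: "'a \<Rightarrow> 'a"
  assumes m: "m \<ge> 2"
    and hom: "\<phi> \<in> hom G G" and bij: "bij_betw \<phi> (carrier G) (carrier G)"
    and par_phi: "x \<in> carrier G \<Longrightarrow> i \<in> {1..m} \<Longrightarrow> par (\<phi> x) i = par x i"
begin

lemma phi_closed [simp]: "x \<in> carrier G \<Longrightarrow> \<phi> x \<in> carrier G"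
  using hom by (auto simp: hom_def)

lemma phi_mult: "x \<in> carrier G \<Longrightarrow> y \<in> carrier G \<Longrightarrow> \<phi> (x \<otimes> y) = \<phi> x \<otimes> \<phi> y"
  using hom by (auto simp: hom_def)

lemma phi_one: "\<phi> \<one> = \<one>"
  using hom_one[OF hom] is_group by simp

lemma phi_inject: "x \<in> carrier G \<Longrightarrow> y \<in> carrier G \<Longrightarrow> \<phi> x = \<phi> y \<longleftrightarrow> x = y"
  using bij by (auto simp: bij_betw_def inj_on_def)

lemma phi_s_reflection:
  assumes "i \<in> {1..m}" shows "\<exists>g\<in>carrier G. \<phi> (s i) = reflection g i"
proof (rule involution_is_reflection)
  show "\<phi> (s i) \<otimes> \<phi> (s i) = \<one>"
    using assms phi_mult[of "s i" "s i"] phi_one s_square by simp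
  show "par (\<phi> (s i)) j \<longleftrightarrow> i = j" if "j \<in> {1..m}" for j
    using that assms par_phi par_s s_closed by simp
qed (use assms in auto)

lemma phi_s_commute_iff:
  assumes "i \<in> {1..m}" "j \<in> {1..m}"
  shows "\<phi> (s i) \<otimes> \<phi> (s j) = \<phi> (s j) \<otimes> \<phi> (s i) \<longleftrightarrow> \<not> (j = Suc i \<or> i = Suc j)"
  using assms s_commute[of i j] s_not_commute[of i j]
  by (metis phi_mult phi_inject m_closed s_closed)

lemma phi_s_inject: "i \<in> {1..m} \<Longrightarrow> j \<in> {1..m} \<Longrightarrow> \<phi> (s i) = \<phi> (s j) \<longleftrightarrow> i = j"
  using phi_inject s_inject s_closed by blast

section \<open>Choice of orientations\<close>

text \<open>The condition on consecutive indices copies the standard half-spaces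
  \<open>side \<one> i\<close>, where adjacent labels are never both negative.\<close>

definition oriented :: "nat \<Rightarrow> (nat \<Rightarrow> 'a) \<Rightarrow> bool" where
  "oriented k g \<longleftrightarrow> (\<forall>i\<in>{1..k}. g i \<in> carrier G \<and> \<phi> (s i) = reflection (g i) i) \<and>
    (\<forall>i. 1 \<le> i \<and> Suc i \<le> k \<longrightarrow>
      (\<forall>x\<in>carrier G. side (g i) i x \<or> side (g (Suc i)) (Suc i) x))"

lemma empty_quadrant_phi:
  assumes "i \<in> {1..m}" "Suc i \<in> {1..m}" "g \<in> carrier G" "\<phi> (s i) = reflection g i"
    and "h \<in> carrier G" "\<phi> (s (Suc i)) = reflection h (Suc i)"
  obtains a c where "\<And>x. x \<in> carrier G \<Longrightarrow> \<not> (side g i x = a \<and> side h (Suc i) x = c)"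
  using empty_quadrant[of g i h "Suc i"] assms phi_s_commute_iff[of i "Suc i"] by metis

text \<open>
  The walls of \<open>\<phi> (s (k - 1))\<close> and \<open>\<phi> (s (k + 1))\<close> cross, so they lie on the same side of the
  wall of \<open>\<phi> (s k)\<close>; hence the orientations can be chosen one after the other.
\<close>

lemma ex_oriented:
  assumes "2 \<le> k" "k \<le> m" shows "\<exists>g. oriented k g"
  using assms
proof (induction k rule: dec_induct)
  case base
  obtain g where g: "g \<in> carrier G" "\<phi> (s 1) = reflection g 1"
    using phi_s_reflection[of 1] m by auto
  obtain h where h: "h \<in> carrier G" "\<phi> (s 2) = reflection h 2"
    using phi_s_reflection[of 2] m by auto
  obtain a c where ac: "\<And>x. x \<in> carrier G \<Longrightarrow> \<not> (side g 1 x = a \<and> side h 2 x = c)"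
    using empty_quadrant_phi[of 1 g h] g h m by (auto simp: numeral_2_eq_2)
  \<comment> \<open>Both walls are oriented so that the empty quadrant becomes the negative-negative
    one.\<close>
  obtain g' where g': "g' \<in> carrier G" "reflection g' 1 = reflection g 1"
    "\<And>x. x \<in> carrier G \<Longrightarrow> side g' 1 x \<longleftrightarrow> side g 1 x = (\<not> a)"
    using reflection_orient[of g 1 "\<not> a"] g m by auto
  obtain h' where h': "h' \<in> carrier G" "reflection h' 2 = reflection h 2"
    "\<And>x. x \<in> carrier G \<Longrightarrow> side h' 2 x \<longleftrightarrow> side h 2 x = (\<not> c)"
    using reflection_orient[of h 2 "\<not> c"] h m by auto
  have "oriented 2 (\<lambda>i. if i = 1 then g' else h')"
    unfolding oriented_def
  proof (intro conjI ballI allI impI)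
    fix i :: nat assume "i \<in> {1..2}"
    then have "i = 1 \<or> i = 2" by auto
    then show "(if i = 1 then g' else h') \<in> carrier G"
      and "\<phi> (s i) = reflection (if i = 1 then g' else h') i"
      using g h g' h' by auto
  next
    fix i :: nat and x assume "1 \<le> i \<and> Suc i \<le> 2" and x: "x \<in> carrier G"
    then have "i = 1" "Suc i = 2" by auto
    then show "side (if i = 1 then g' else h') i x \<or>
      side (if Suc i = 1 then g' else h') (Suc i) x"
      using ac[OF x] g'(3)[OF x] h'(3)[OF x] by (auto simp: numeral_2_eq_2)
  qed
  then show ?case by blast
next
  case (step k)
  then obtain g where g: "oriented k g" by auto
  have gi: "g i \<in> carrier G" "\<phi> (s i) = reflection (g i) i" if "i \<in> {1..k}" for i
    using g that by (auto simp: oriented_def)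
  obtain h where h: "h \<in> carrier G" "\<phi> (s (Suc k)) = reflection h (Suc k)"
    using phi_s_reflection[of "Suc k"] step by auto
  obtain a c where ac: "\<And>x. x \<in> carrier G \<Longrightarrow> \<not> (side (g k) k x = a \<and> side h (Suc k) x = c)"
    using empty_quadrant_phi[of k "g k" h] gi[of k] h step by auto
  define l where "l = k - 1"
  have l: "k = Suc l" "l \<in> {1..k}" using step by (auto simp: l_def)
  \<comment> \<open>Some point lies outside the half-space of \<open>l\<close> and on side
    \<open>c\<close> of the new wall, as these walls cross. It is inside the half-space of
    \<open>k\<close>, so the empty quadrant must be outside it.\<close>
  have "\<not> a"
  proof
    assume a
    obtain x where x: "x \<in> carrier G" "\<not> side (g l) l x" "side h (Suc k) x = c"
      using quadrant_nonempty[of "g l" l h "Suc k" False c] gi[of l] h l step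
        phi_s_commute_iff[of l "Suc k"] phi_s_inject[of l "Suc k"] by auto
    then have "side (g k) k x" using g l by (auto simp: oriented_def)
    then show False using ac x \<open>a\<close> by blast
  qed
  obtain h' where h': "h' \<in> carrier G" "reflection h' (Suc k) = reflection h (Suc k)"
    "\<And>x. x \<in> carrier G \<Longrightarrow> side h' (Suc k) x \<longleftrightarrow> side h (Suc k) x = (\<not> c)"
    using reflection_orient[of h "Suc k" "\<not> c"] h step by auto
  have "side (g k) k x \<or> side h' (Suc k) x" if "x \<in> carrier G" for x
    using ac[OF that] h'(3)[OF that] \<open>\<not> a\<close> by auto
  then have "oriented (Suc k) (g(Suc k := h'))"
    using g h h' by (auto simp: oriented_def le_Suc_eq)
  then show ?case by blast
qed

section \<open>A common point of the half-spaces and ping-pong\<close>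

context
  fixes g assumes oriented: "oriented m g"
begin

lemma g_closed: "i \<in> {1..m} \<Longrightarrow> g i \<in> carrier G"
  and phi_s: "i \<in> {1..m} \<Longrightarrow> \<phi> (s i) = reflection (g i) i"
  using oriented by (auto simp: oriented_def)

lemma side_adjacent:
  assumes "i \<in> {1..m}" "j \<in> {1..m}" "j = Suc i \<or> i = Suc j" "x \<in> carrier G"
    and "\<not> side (g i) i x"
  shows "side (g j) j x"
  using assms oriented by (auto simp: oriented_def)

lemma side_phi_s_same:
  "i \<in> {1..m} \<Longrightarrow> x \<in> carrier G \<Longrightarrow> side (g i) i (\<phi> (s i) \<otimes> x) \<longleftrightarrow> \<not> side (g i) i x"
  using side_reflect g_closed phi_s by simp

lemma side_phi_s_commuting:
  assumes "i \<in> {1..m}" "j \<in> {1..m}" "i \<noteq> j" "\<not> (j = Suc i \<or> i = Suc j)" "x \<in> carrier G"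
  shows "side (g i) i (\<phi> (s j) \<otimes> x) \<longleftrightarrow> side (g i) i x"
  using side_invariant[of "g i" i "g j" j x] assms g_closed phi_s phi_s_commute_iff[of i j]
    phi_s_inject[of i j] by simp

text \<open>Both values of \<open>a\<close> are carried along: the point outside the last half-space
  is the source of the points for the next index.\<close>

lemma Helly:
  assumes "k < m"
  shows "\<exists>x\<in>carrier G. (\<forall>i\<in>{1..k}. side (g i) i x) \<and> side (g (Suc k)) (Suc k) x = a"
  using assms
proof (induction k arbitrary: a)
  case 0
  have "g 1 \<in> carrier G" "s 1 \<in> carrier G" using g_closed[of 1] s_closed[of 1] m by auto
  then show ?case
    using side_self[of "g 1" 1] side_phi_s_same[of 1 "g 1"] phi_closed[of "s 1"] m
    by (cases a) (auto intro: bexI[of _ "g 1"] bexI[of _ "\<phi> (s 1) \<otimes> g 1"])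
next
  case (Suc k)
  let ?i = "Suc k" and ?j = "Suc (Suc k)"
  have ij: "?i \<in> {1..m}" "?j \<in> {1..m}" using Suc.prems by auto
  obtain y where y: "y \<in> carrier G" "\<forall>i\<in>{1..k}. side (g i) i y" "\<not> side (g ?i) ?i y"
    using Suc.IH[of False] Suc.prems by auto
  have yj: "side (g ?j) ?j y" using side_adjacent[of ?i ?j y] y ij by simp
  \<comment> \<open>This reflection leaves the half-space of \<open>?j\<close>, so it lands in that
    of \<open>?i\<close>. It preserves the earlier half-spaces by commutation.\<close>
  let ?z = "\<phi> (s ?j) \<otimes> y"
  have z: "?z \<in> carrier G" using y ij s_closed[of ?j] by simp
  have zj: "\<not> side (g ?j) ?j ?z" using side_phi_s_same[of ?j y] y ij yj by simp
  then have zi: "side (g ?i) ?i ?z" using side_adjacent[of ?j ?i ?z] ij z by simp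
  have zk: "\<forall>i\<in>{1..k}. side (g i) i ?z"
    using side_phi_s_commuting[of _ ?j y] y ij Suc.prems by auto
  show ?case
  proof (cases a)
    case False
    then show ?thesis using z zj zi zk by (intro bexI[of _ ?z]) (auto simp: le_Suc_eq)
  next
    case True
    \<comment> \<open>Some edge on a walk from \<open>y\<close> to \<open>?z\<close> enters the
      half-space of \<open>?i\<close>. Its start lies outside that one, hence inside the one of
      \<open>?j\<close>, whose wall the same edge cannot cross.\<close>
    let ?F = "(\<lambda>i. (g i, i)) ` {1..k}"
    have "\<exists>x\<in>carrier G. \<exists>j\<in>{1..m}.
        (\<forall>(h, i)\<in>?F. side h i x \<and> side h i (x \<otimes> s j)) \<and>
        side (g ?i) ?i x = side (g ?i) ?i y \<and> side (g ?i) ?i (x \<otimes> s j) = side (g ?i) ?i ?z"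
      by (rule convex_crossing) (use y z zi zk ij g_closed Suc.prems in auto)
    then obtain x j where x: "x \<in> carrier G" "j \<in> {1..m}"
      "\<forall>i\<in>{1..k}. side (g i) i (x \<otimes> s j)" "\<not> side (g ?i) ?i x" "side (g ?i) ?i (x \<otimes> s j)"
      using y zi by auto
    have "side (g ?j) ?j x" using side_adjacent[of ?i ?j x] x ij by simp
    moreover have "reflection (g ?i) ?i = reflection x j"
      using side_cross_iff[of "g ?i" ?i x j] x ij g_closed by simp
    then have "reflection (g ?j) ?j \<noteq> reflection x j"
      using phi_s phi_s_inject[of ?i ?j] ij by simp
    ultimately have "side (g ?j) ?j (x \<otimes> s j)"
      using side_cross_iff[of "g ?j" ?j x j] x ij g_closed by simp
    then show ?thesis
      using True x s_closed[of j] by (intro bexI[of _ "x \<otimes> s j"]) (auto simp: le_Suc_eq)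
  qed
qed

text \<open>A new first letter \<open>b\<close> moves the point out of the half-space of
  \<open>b\<close>, hence into those of its neighbours, and keeps it on the same side of the
  remaining walls. The labels of \<open>v\<close> change sign in the same way.\<close>

lemma ping_pong:
  assumes x: "x \<in> carrier G" "\<And>i. i \<in> {1..m} \<Longrightarrow> side (g i) i x"
    and "v \<in> carrier G" "i \<in> {1..m}"
  shows "side (g i) i (\<phi> v \<otimes> x) \<longleftrightarrow> val v i > 0"
  using assms(3,4)
proof (induction "len v" arbitrary: v i rule: less_induct)
  case less
  from \<open>v \<in> carrier G\<close> show ?case
  proof (cases rule: reduced_cases)
    case one
    then show ?thesis using less.prems x phi_one by (simp add: val_one)
  next
    case (step b u)
    have IH: "side (g i) i (\<phi> u \<otimes> x) \<longleftrightarrow> val u i > 0" if "i \<in> {1..m}" for i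
      using less.hyps[of u] step that by simp
    have eq: "\<phi> v \<otimes> x = \<phi> (s b) \<otimes> (\<phi> u \<otimes> x)"
      using step x s_closed[of b] by (simp add: phi_mult m_assoc)
    have cl: "\<phi> v \<otimes> x \<in> carrier G" "\<phi> u \<otimes> x \<in> carrier G" using less.prems step x by auto
    have b: "val u b > 0" using val_pos_of_reduced[of b u] step by auto
    then have vb: "val v b < 0" using step val_mult[of b b u] by simp
    have sb: "\<not> side (g b) b (\<phi> v \<otimes> x)"
      using side_phi_s_same[of b "\<phi> u \<otimes> x"] IH[of b] eq step cl b by simp
    consider "i = b" | "i = Suc b \<or> b = Suc i" | "i \<noteq> b" "\<not> (i = Suc b \<or> b = Suc i)" by blast
    then show ?thesis
    proof cases
      case 1
      then show ?thesis using vb sb by simp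
    next
      case 2
      then show ?thesis
        using side_adjacent[of b i "\<phi> v \<otimes> x"] val_adj[of v b i] vb sb cl step(1) less.prems
        by simp
    next
      case 3
      then have "val v i = val u i" using val_mult[of b i u] step less.prems by simp
      then show ?thesis
        using side_phi_s_commuting[of i b "\<phi> u \<otimes> x"] 3 IH[of i] eq step(1) cl less.prems by auto
    qed
  qed
qed

lemma phi_s_common_conjugator: "\<exists>x\<in>carrier G. \<forall>j\<in>{1..m}. \<phi> (s j) = reflection x j"
proof -
  have m1: "m - 1 < m" "Suc (m - 1) = m" using m by auto
  obtain x where x: "x \<in> carrier G" "\<forall>i\<in>{1..m - 1}. side (g i) i x" "side (g m) m x"
    using Helly[OF m1(1), of True] m1 by auto
  have sx: "side (g i) i x" if "i \<in> {1..m}" for i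
    using x that by (cases "i = m") auto
  \<comment> \<open>By surjectivity \<open>y = \<phi> v \<otimes> x\<close>; ping-pong makes all
    labels of \<open>v\<close> positive.\<close>
  have unique: "y = x" if y: "y \<in> carrier G" "\<And>i. i \<in> {1..m} \<Longrightarrow> side (g i) i y" for y
  proof -
    have "y \<otimes> inv x \<in> \<phi> ` carrier G" using bij x y by (simp add: bij_betw_def)
    then obtain v where v: "v \<in> carrier G" "\<phi> v = y \<otimes> inv x" by auto
    then have "\<phi> v \<otimes> x = y" using x y by (simp add: m_assoc)
    then have "v = \<one>" using eq_one_if_val_pos[of v] ping_pong[OF x(1) sx v(1)] v y by simp
    then show ?thesis using \<open>\<phi> v \<otimes> x = y\<close> phi_one x by simp
  qed
  have "\<phi> (s j) = reflection x j" if j: "j \<in> {1..m}" for j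
  proof -
    have "par (x \<otimes> s j) j \<noteq> par x j" using par_mult par_s j x s_closed[of j] by simp
    then have "x \<otimes> s j \<noteq> x" by auto
    \<comment> \<open>By uniqueness the edge to \<open>x \<otimes> s j\<close> leaves some
      half-space, so it crosses the wall of \<open>\<phi> (s i)\<close>; parity then identifies
      \<open>i\<close> with \<open>j\<close>.\<close>
    then obtain i where i: "i \<in> {1..m}" "\<not> side (g i) i (x \<otimes> s j)"
      using unique[of "x \<otimes> s j"] x j s_closed[of j] by blast
    then have "reflection (g i) i = reflection x j"
      using side_cross_iff[of "g i" i x j] sx[of i] g_closed[of i] x j by auto
    moreover from this have "i = j"
      using par_reflection[of "g i" i j] par_reflection[of x j j] g_closed[of i] i j x by simp
    ultimately show ?thesis using phi_s i by simp
  qed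
  then show ?thesis using x by blast
qed

end

lemma phi_inner: "\<exists>x\<in>carrier G. \<forall>y\<in>carrier G. \<phi> y = x \<otimes> y \<otimes> inv x"
proof -
  obtain g where "oriented m g" using ex_oriented[of m] m by auto
  then obtain x where x: "x \<in> carrier G" "\<forall>j\<in>{1..m}. \<phi> (s j) = reflection x j"
    using phi_s_common_conjugator by blast
  have "\<phi> y = x \<otimes> y \<otimes> inv x" if "y \<in> carrier G" for y
    using that
  proof (induction rule: generator_induct)
    case one
    then show ?case using phi_one x by simp
  next
    case (mult i y)
    then show ?case using x s_closed[of i] by (simp add: phi_mult reflection_def m_assoc)
  qed
  then show ?thesis using x by blast
qed

end

section \<open>Twin groups\<close>

definition numbers_step :: "nat \<Rightarrow> (nat \<Rightarrow> int) \<Rightarrow> nat \<Rightarrow> int" where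
  "numbers_step i f = (\<lambda>j. if j = i then - f i
    else if j = Suc i \<or> i = Suc j then f j + 2 * f i else f j)"

text \<open>The signs of letters are ignored because each move is an involution.\<close>

definition word_numbers :: "nat word \<Rightarrow> (nat \<Rightarrow> int) \<Rightarrow> nat \<Rightarrow> int" where
  "word_numbers w = foldr (\<lambda>x. numbers_step (fst x)) w"

definition word_parity :: "nat word \<Rightarrow> nat \<Rightarrow> bool" where
  "word_parity w i = odd (count_list (map fst w) i)"

definition twin_class :: "nat \<Rightarrow> nat word \<Rightarrow> nat word set" where
  "twin_class n w = word_rel {1..n - 1} (twin_relations n) `` {w}"

lemma numbers_step_square: "numbers_step i (numbers_step i f) = f"
  by (auto simp: numbers_step_def fun_eq_iff)

lemma numbers_step_commute:
  "\<bar>int i - int j\<bar> \<ge> 2 \<Longrightarrow> numbers_step i (numbers_step j f) = numbers_step j (numbers_step i f)"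
  by (auto simp: numbers_step_def fun_eq_iff)

lemma word_numbers_append: "word_numbers (v @ w) = word_numbers v \<circ> word_numbers w"
  by (simp add: word_numbers_def fun_eq_iff)

lemma word_parity_append: "word_parity (v @ w) = (\<lambda>i. word_parity v i \<noteq> word_parity w i)"
  by (auto simp: word_parity_def)

text \<open>The moves satisfy the defining relations, so labels and parities are well defined on
  classes of words.\<close>

lemma word_rel_invariants:
  "(v, w) \<in> word_rel {1..n - 1} (twin_relations n) \<Longrightarrow>
    word_numbers v = word_numbers w \<and> word_parity v = word_parity w"
proof (induction rule: word_rel.induct)
  case (relation u v l r)
  have "word_numbers l = word_numbers r"
    using relation(3)
    by (auto simp: twin_relations_def word_numbers_def fun_eq_iff numbers_step_square
        numbers_step_commute)
  moreover have "word_parity l = word_parity r"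
    using relation(3) by (auto simp: twin_relations_def word_parity_def fun_eq_iff split: if_splits)
  ultimately show ?case by (simp add: word_numbers_append word_parity_append)
next
  case (cancel u v a b)
  have "word_numbers [(a, b), (a, \<not> b)] = word_numbers []"
    "word_parity [(a, b), (a, \<not> b)] = word_parity []"
    by (auto simp: word_numbers_def word_parity_def fun_eq_iff numbers_step_square)
  then show ?case
    by (simp only: word_numbers_append word_parity_append)
      (simp add: word_numbers_def word_parity_def)
qed auto

lemma twin_class_eq_iff:
  assumes "v \<in> words {1..n - 1}" "w \<in> words {1..n - 1}"
  shows "twin_class n v = twin_class n w \<longleftrightarrow> (v, w) \<in> word_rel {1..n - 1} (twin_relations n)"
  unfolding twin_class_def using eq_equiv_class_iff[OF equiv_word_rel] assms by blast

lemma carrier_twin_group: "carrier (twin_group n) = twin_class n ` words {1..n - 1}"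
  by (auto simp: twin_group_def presented_group_def quotient_def twin_class_def)

lemma twin_class_mult:
  "v \<in> words {1..n - 1} \<Longrightarrow> w \<in> words {1..n - 1} \<Longrightarrow>
    twin_class n v \<otimes>\<^bsub>twin_group n\<^esub> twin_class n w = twin_class n (v @ w)"
  unfolding twin_class_def twin_group_def by (rule presented_group_mult)

lemma twin_class_one: "\<one>\<^bsub>twin_group n\<^esub> = twin_class n []"
  by (simp add: twin_group_def presented_group_def twin_class_def)

definition twin_val :: "nat word set \<Rightarrow> nat \<Rightarrow> int" where
  "twin_val X = word_numbers (SOME w. w \<in> X) (\<lambda>_. 1)"

definition twin_par :: "nat word set \<Rightarrow> nat \<Rightarrow> bool" where
  "twin_par X = word_parity (SOME w. w \<in> X)"

lemma twin_class_some:
  assumes "w \<in> words {1..n - 1}"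
  shows "(w, SOME v. v \<in> twin_class n w) \<in> word_rel {1..n - 1} (twin_relations n)"
proof -
  have "w \<in> twin_class n w" using assms by (simp add: twin_class_def word_rel.refl)
  then have "(SOME v. v \<in> twin_class n w) \<in> twin_class n w" by (rule someI)
  then show ?thesis by (simp add: twin_class_def)
qed

lemma twin_val_class:
  "w \<in> words {1..n - 1} \<Longrightarrow> twin_val (twin_class n w) = word_numbers w (\<lambda>_. 1)"
  using word_rel_invariants[OF twin_class_some] by (simp add: twin_val_def)

lemma twin_par_class:
  "w \<in> words {1..n - 1} \<Longrightarrow> twin_par (twin_class n w) = word_parity w"
  using word_rel_invariants[OF twin_class_some] by (simp add: twin_par_def)

lemma twin_class_relation:
  assumes "(l, r) \<in> twin_relations n" "l \<in> words {1..n - 1}" "r \<in> words {1..n - 1}"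
  shows "twin_class n l = twin_class n r"
  using word_rel.relation[of "[]" "{1..n - 1}" "[]" l r "twin_relations n"] assms
  by (simp add: twin_class_eq_iff)

text \<open>The word i i i^-1 reduces to i by cancellation and to i^-1 by the relation. Hence words
  without formal inverses generate.\<close>

lemma twin_class_letter:
  assumes "i \<in> {1..n - 1}" shows "twin_class n [(i, b)] = twin_class n [(i, True)]"
proof (cases b)
  case False
  let ?R = "word_rel {1..n - 1} (twin_relations n)"
  have "([(i, True)] @ [(i, True), (i, \<not> True)] @ [], [(i, True)] @ []) \<in> ?R"
    using assms by (intro word_rel.cancel) auto
  moreover have "([] @ [(i, True), (i, True)] @ [(i, False)], [] @ [] @ [(i, False)]) \<in> ?R"
    using assms by (intro word_rel.relation) (auto simp: twin_relations_def)
  ultimately have "([(i, False)], [(i, True)]) \<in> ?R"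
    by (metis append_Cons append_Nil append_Nil2 word_rel.sym word_rel.trans)
  then show ?thesis using False assms by (simp add: twin_class_eq_iff)
qed simp

lemma right_angled_twin_group:
  "right_angled (twin_group n) {1..n - 1} (\<lambda>i. twin_class n [(i, True)])
    (\<lambda>i j. j = Suc i \<or> i = Suc j) twin_val twin_par"
proof -
  interpret group "twin_group n" by (rule group_twin_group)
  show ?thesis
  proof
    fix i assume i: "i \<in> {1..n - 1}"
    then show "twin_class n [(i, True)] \<in> carrier (twin_group n)"
      by (auto simp: carrier_twin_group)
    show "twin_class n [(i, True)] \<otimes>\<^bsub>twin_group n\<^esub> twin_class n [(i, True)] = \<one>\<^bsub>twin_group n\<^esub>"
      using i twin_class_relation[of "[(i, True), (i, True)]" "[]" n]
      by (auto simp: twin_class_mult twin_class_one twin_relations_def)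
    show "twin_val \<one>\<^bsub>twin_group n\<^esub> i = 1"
      by (simp add: twin_class_one twin_val_class word_numbers_def)
    fix j assume j: "j \<in> {1..n - 1}"
    show "twin_par (twin_class n [(i, True)]) j = (i = j)"
      using i by (simp add: twin_par_class word_parity_def)
    show "twin_class n [(i, True)] \<otimes>\<^bsub>twin_group n\<^esub> twin_class n [(j, True)] =
        twin_class n [(j, True)] \<otimes>\<^bsub>twin_group n\<^esub> twin_class n [(i, True)]"
      if "\<not> (j = Suc i \<or> i = Suc j)"
    proof (cases "i = j")
      case False
      then have "\<bar>int i - int j\<bar> \<ge> 2" using that by auto
      then have "([(i, True), (j, True)], [(j, True), (i, True)]) \<in> twin_relations n"
        using i j by (auto simp: twin_relations_def)
      then show ?thesis using i j twin_class_relation by (simp add: twin_class_mult)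
    qed simp
    fix x assume "x \<in> carrier (twin_group n)"
    then obtain w where w: "w \<in> words {1..n - 1}" "x = twin_class n w"
      by (auto simp: carrier_twin_group)
    show "twin_val (twin_class n [(i, True)] \<otimes>\<^bsub>twin_group n\<^esub> x) j =
        (if j = i then - twin_val x i
         else if j = Suc i \<or> i = Suc j then twin_val x j + 2 * twin_val x i else twin_val x j)"
      using w i by (simp add: twin_class_mult twin_val_class word_numbers_def numbers_step_def)
  next
    fix i x y assume i: "i \<in> {1..n - 1}"
      and x: "x \<in> carrier (twin_group n)" and y: "y \<in> carrier (twin_group n)"
    from x y obtain v w where "v \<in> words {1..n - 1}" "x = twin_class n v"
      "w \<in> words {1..n - 1}" "y = twin_class n w"
      by (auto simp: carrier_twin_group)
    then show "twin_par (x \<otimes>\<^bsub>twin_group n\<^esub> y) i = (twin_par x i \<noteq> twin_par y i)"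
      by (simp add: twin_class_mult twin_par_class word_parity_def)
  next
    fix x assume "x \<in> carrier (twin_group n)"
    then obtain w where w: "w \<in> words {1..n - 1}" "x = twin_class n w"
      by (auto simp: carrier_twin_group)
    let ?prod = "\<lambda>v. foldr (\<lambda>i y. twin_class n [(i, True)] \<otimes>\<^bsub>twin_group n\<^esub> y) v \<one>\<^bsub>twin_group n\<^esub>"
    have "twin_class n w = ?prod (map fst w) \<and> set (map fst w) \<subseteq> {1..n - 1}"
      using w(1)
    proof (induction w)
      case (Cons x w)
      obtain i b where x: "x = (i, b)" by fastforce
      have "twin_class n (x # w) = twin_class n [(i, b)] \<otimes>\<^bsub>twin_group n\<^esub> twin_class n w"
        using Cons.prems x by (subst twin_class_mult) auto
      then show ?case using Cons x twin_class_letter[of i n b] by simp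
    qed (simp add: twin_class_one)
    then show "\<exists>v. set v \<subseteq> {1..n - 1} \<and> x = ?prod v" using w by blast
  qed auto
qed

theorem proposition6p13:
  fixes n :: nat and \<phi> :: "nat word set \<Rightarrow> nat word set"
  assumes "n \<ge> 3"
    and "\<phi> \<in> IA_automorphisms (twin_group n)"
  shows "\<phi> \<in> inner_automorphisms (twin_group n)"
proof -
  let ?G = "twin_group n"
  interpret right_angled ?G "{1..n - 1}" "\<lambda>i. twin_class n [(i, True)]"
    "\<lambda>i j. j = Suc i \<or> i = Suc j" twin_val twin_par
    by (rule right_angled_twin_group)
  have auto: "\<phi> \<in> hom ?G ?G" "\<phi> \<in> Bij (carrier ?G)"
    using assms(2) by (auto simp: IA_automorphisms_def auto_def)
  interpret path_right_angled ?G "n - 1" "\<lambda>i. twin_class n [(i, True)]" twin_val twin_par \<phi>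
    using assms auto par_IA_automorphism by unfold_locales (auto simp: Bij_def)
  obtain x where x: "x \<in> carrier ?G"
    "\<forall>y\<in>carrier ?G. \<phi> y = x \<otimes>\<^bsub>?G\<^esub> y \<otimes>\<^bsub>?G\<^esub> inv\<^bsub>?G\<^esub> x"
    using phi_inner by blast
  \<comment> \<open>Both maps are extensional on the carrier, so agreement there suffices.\<close>
  have "\<phi> = (\<lambda>y\<in>carrier ?G. x \<otimes>\<^bsub>?G\<^esub> y \<otimes>\<^bsub>?G\<^esub> inv\<^bsub>?G\<^esub> x)"
    using x auto(2) by (intro extensionalityI[of _ "carrier ?G"]) (auto simp: Bij_def)
  then show ?thesis using x(1) by (auto simp: inner_automorphisms_def)
qed

end
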